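(* Let $(\mathcal{A},\varphi,\varphi')$ be an infinitesimal probability space and $j\in\mathcal{A}$ an infinitesimal idempotent with $\varphi'(j)\ne0$; put $\psi(a)=\varphi'(aj)/\varphi'(j)$ for $a\in\mathcal{A}$. Suppose that $\mathcal{B}$ and $\mathcal{C}$ are unital subalgebras of $\mathcal{A}$ and that $\{\mathcal{B},\mathcal{C}\}$ are infinitesimally free from $j$. Then $(j\mathcal{J}(\mathcal{B})j,\mathcal{C})$ are monotone independent with respect to $\psi$. Furthermore, if $\mathcal{B}$ and $\mathcal{C}$ are free, then $(\mathcal{J}_a(\mathcal{B}),\mathcal{C})$ are monotone independent with respect to $\psi$.
   Context: An infinitesimal probability space $(\mathcal{A},\varphi,\varphi')$ is a unital algebra $\mathcal{A}$ over $\mathbb{C}$ with linear functionals $\varphi,\varphi'$ such that $\varphi(1)=1$, $\varphi'(1)=0$. An infinitesimal idempotent is $j\in\mathcal{A}$ with $j^2=j$ and $\varphi(j^n)=0$ for all $n\ge1$. Unital subalgebras $(\mathcal{C}_i)$ are infinitesimally free if, whenever $a_k\in\mathcal{C}_{i_k}$ with consecutive indices distinct and $\varphi(a_k)=0$ for all $k$, one has $\varphi(a_1\cdots a_n)=0$ and $\varphi'(a_1\cdots a_n)=\sum_{k=1}^n\varphi'(a_k)\varphi(a_1\cdots a_{k-1}a_{k+1}\cdots a_n)$; they are free (with respect to $\varphi$) if, whenever $a_k\in\mathcal{C}_{i_k}$ with consecutive indices distinct and $\varphi(a_k)=0$ for all $k$, one has $\varphi(a_1\cdots a_n)=0$. That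 $\{\mathcal{B},\mathcal{C}\}$ are infinitesimally free from $j$ means: the unital algebra generated by $\mathcal{B}\cup\mathcal{C}$ and the unital algebra generated by $j$ are infinitesimally free. A pair of (not necessarily unital) subalgebras $(\mathcal{D},\mathcal{C})$ is monotone independent with respect to $\psi$ (written $\mathcal{D}\prec\mathcal{C}$) if, whenever $a_1,\dots,a_n\in\mathcal{D}\cup\mathcal{C}$ and $a_{k-1}\in\mathcal{D}$, $a_k\in\mathcal{C}$, $a_{k+1}\in\mathcal{D}$ for some $k$, one has $\psi(a_1\cdots a_n)=\psi(a_1\cdots a_{k-1}\psi(a_k)a_{k+1}\cdots a_n)$, where the condition on $a_{k-1}$ (resp. $a_{k+1}$) is dropped if $k=1$ (resp. $k=n$). Write $j^{(-1)}=j$, $j^{(1)}=j^\perp:=1-j$. $\mathcal{J}(\mathcal{B})$ is the algebra generated by the words $j^{(\varepsilon_1)}a_1j^{(\varepsilon_2)}a_2\cdots j^{(\varepsilon_{k-1})}a_{k-1}j^{(\varepsilon_k)}$ with $k\ge0$, $\varepsilon_1,\dots,\varepsilon_k\in\{-1,1\}$ and $a_1,a_2,\dots,a_k\in\mathcal{B}$ (so for $k=1$ the word is $j^{(\varepsilon_1)}$). $\mathcal{J}_a(\mathcal{B})$ is the subalgebra of $\mathcal{J}(\mathcal{B})$ generated by those of these words for which $\varepsilon_1\neq\varepsilon_2\neq\cdots\neq\varepsilon_{k-1}\neq\varepsilon_k$ (consecutive signs distinct). $j\mathcal{J}(\mathcal{B})j=\{jxj:x\in\mathcal{J}(\mathc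al{B})\}$.
   Formalization: J_a(B) is generated by the alternating words in which j itself occurs, so the empty word 1 and the single letter 1−j are excluded; with them J_a(B) contains 1 and the second claim fails, as it would force φ to be multiplicative on C. *)

theory Defs
  imports Complex_Main
begin

section \<open>Infinitesimal probability spaces\<close>

text \<open>
  HOL has no type class of complex algebras. The algebra is a type of class \<open>ring_1\<close> together with
  a scalar multiplication \<open>scale\<close>. That \<open>0 \<noteq> 1\<close> in this class is no restriction, as
  \<open>\<phi> 1 = 1\<close> and \<open>\<phi> 0 = 0\<close>.
\<close>

locale unital_complex_algebra = vector_space scale
  for scale :: "complex \<Rightarrow> 'a::ring_1 \<Rightarrow> 'a" +
  assumes scale_mult_left: "scale c a * b = scale c (a * b)"
    and mult_scale_right: "a * scale c b = scale c (a * b)"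

locale infinitesimal_probability_space = unital_complex_algebra scale
  for scale :: "complex \<Rightarrow> 'a::ring_1 \<Rightarrow> 'a" +
  fixes \<phi> \<phi>' :: "'a \<Rightarrow> complex"
  assumes linear_phi: "Vector_Spaces.linear scale (*) \<phi>"
    and linear_phi': "Vector_Spaces.linear scale (*) \<phi>'"
    and phi_one: "\<phi> 1 = 1"
    and phi'_one: "\<phi>' 1 = 0"

definition infinitesimal_idempotent :: "('a::ring_1 \<Rightarrow> complex) \<Rightarrow> 'a \<Rightarrow> bool" where
  "infinitesimal_idempotent \<phi> j \<longleftrightarrow> j ^ 2 = j \<and> (\<forall>n\<ge>1. \<phi> (j ^ n) = 0)"

definition subalgebra :: "(complex \<Rightarrow> 'a::ring_1 \<Rightarrow> 'a) \<Rightarrow> 'a set \<Rightarrow> bool" where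
  "subalgebra scale S \<longleftrightarrow> module.subspace scale S \<and> (\<forall>x\<in>S. \<forall>y\<in>S. x * y \<in> S)"

definition unital_subalgebra :: "(complex \<Rightarrow> 'a::ring_1 \<Rightarrow> 'a) \<Rightarrow> 'a set \<Rightarrow> bool" where
  "unital_subalgebra scale S \<longleftrightarrow> subalgebra scale S \<and> 1 \<in> S"

definition generated_algebra :: "(complex \<Rightarrow> 'a::ring_1 \<Rightarrow> 'a) \<Rightarrow> 'a set \<Rightarrow> 'a set" where
  "generated_algebra scale X = subalgebra scale hull X"

definition generated_unital_algebra :: "(complex \<Rightarrow> 'a::ring_1 \<Rightarrow> 'a) \<Rightarrow> 'a set \<Rightarrow> 'a set" where
  "generated_unital_algebra scale X = unital_subalgebra scale hull X"

section \<open>Independence\<close>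

text \<open>
  \<open>is\<close> and \<open>as\<close> list the indices \<open>i\<^sub>1, \<dots>, i\<^sub>n\<close> and the elements \<open>a\<^sub>1, \<dots>, a\<^sub>n\<close>, where \<open>n \<ge> 1\<close>;
  list positions count from 0.
\<close>

definition centered_alternating ::
    "('a \<Rightarrow> complex) \<Rightarrow> ('i \<Rightarrow> 'a set) \<Rightarrow> 'i list \<Rightarrow> 'a list \<Rightarrow> bool" where
  "centered_alternating \<phi> C is as \<longleftrightarrow>
     as \<noteq> [] \<and> length is = length as \<and> distinct_adj is \<and>
     (\<forall>k<length as. as ! k \<in> C (is ! k) \<and> \<phi> (as ! k) = 0)"

definition freely_independent ::
    "(complex \<Rightarrow> 'a::ring_1 \<Rightarrow> 'a) \<Rightarrow> ('a \<Rightarrow> complex) \<Rightarrow> ('i \<Rightarrow> 'a set) \<Rightarrow> bool" where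
  "freely_independent scale \<phi> C \<longleftrightarrow>
     (\<forall>i. unital_subalgebra scale (C i)) \<and>
     (\<forall>is as. centered_alternating \<phi> C is as \<longrightarrow> \<phi> (prod_list as) = 0)"

definition infinitesimally_free ::
    "(complex \<Rightarrow> 'a::ring_1 \<Rightarrow> 'a) \<Rightarrow> ('a \<Rightarrow> complex) \<Rightarrow> ('a \<Rightarrow> complex) \<Rightarrow> ('i \<Rightarrow> 'a set) \<Rightarrow> bool" where
  "infinitesimally_free scale \<phi> \<phi>' C \<longleftrightarrow>
     (\<forall>i. unital_subalgebra scale (C i)) \<and>
     (\<forall>is as. centered_alternating \<phi> C is as \<longrightarrow>
        \<phi> (prod_list as) = 0 \<and>
        \<phi>' (prod_list as) =
          (\<Sum>k<length as. \<phi>' (as ! k) * \<phi> (prod_list (take k as @ drop (Suc k) as))))"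

definition monotone_independent ::
    "(complex \<Rightarrow> 'a::ring_1 \<Rightarrow> 'a) \<Rightarrow> ('a \<Rightarrow> complex) \<Rightarrow> 'a set \<Rightarrow> 'a set \<Rightarrow> bool" where
  "monotone_independent scale \<psi> D C \<longleftrightarrow>
     subalgebra scale D \<and> subalgebra scale C \<and>
     (\<forall>as k. set as \<subseteq> D \<union> C \<and> k < length as \<and> as ! k \<in> C \<and>
        (0 < k \<longrightarrow> as ! (k - 1) \<in> D) \<and> (Suc k < length as \<longrightarrow> as ! Suc k \<in> D) \<longrightarrow>
        \<psi> (prod_list as) = \<psi> (prod_list (as[k := scale (\<psi> (as ! k)) 1])))"

section \<open>Words in an idempotent and its complement\<close>

definition signed_idem :: "'a::ring_1 \<Rightarrow> int \<Rightarrow> 'a" where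
  "signed_idem j \<epsilon> = (if \<epsilon> = - 1 then j else 1 - j)"

text \<open>
  \<open>idem_word j \<epsilon>\<^sub>1 [(a\<^sub>1, \<epsilon>\<^sub>2), \<dots>, (a\<^sub>k\<^sub>-\<^sub>1, \<epsilon>\<^sub>k)]\<close> is the word
  \<open>j\<^sup>(\<^sup>\<epsilon>\<^sup>1\<^sup>) a\<^sub>1 j\<^sup>(\<^sup>\<epsilon>\<^sup>2\<^sup>) \<dots> a\<^sub>k\<^sub>-\<^sub>1 j\<^sup>(\<^sup>\<epsilon>\<^sup>k\<^sup>)\<close> with \<open>k \<ge> 1\<close>; the empty word, \<open>k = 0\<close>, is \<open>1\<close>.
\<close>

primrec idem_word :: "'a::ring_1 \<Rightarrow> int \<Rightarrow> ('a \<times> int) list \<Rightarrow> 'a" where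
  "idem_word j \<epsilon> [] = signed_idem j \<epsilon>"
| "idem_word j \<epsilon> (p # ps) = signed_idem j \<epsilon> * fst p * idem_word j (snd p) ps"

definition idem_algebra :: "(complex \<Rightarrow> 'a::ring_1 \<Rightarrow> 'a) \<Rightarrow> 'a \<Rightarrow> 'a set \<Rightarrow> 'a set" where
  "idem_algebra scale j B = generated_algebra scale
     (insert 1 {idem_word j \<epsilon> ps | \<epsilon> ps.
        set (\<epsilon> # map snd ps) \<subseteq> {- 1, 1} \<and> fst ` set ps \<subseteq> B})"

text \<open>
  The generators are the alternating words in which the letter \<open>j\<close> itself occurs. This leaves out
  exactly the two degenerate words without sign change and without \<open>j\<close>, namely the empty word
  and the single letter \<open>1 - j\<close>. With either of them (as \<open>j + (1 - j) = 1\<close>) the algebra would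
  contain \<open>1\<close>, and monotone independence of a pair \<open>(D, C)\<close> with \<open>1 \<in> D\<close> makes \<open>\<psi>\<close> multiplicative
  on \<open>C\<close>: apply it to \<open>c\<^sub>1 * 1 * c\<^sub>2\<close>.
\<close>

definition alternating_idem_algebra ::
    "(complex \<Rightarrow> 'a::ring_1 \<Rightarrow> 'a) \<Rightarrow> 'a \<Rightarrow> 'a set \<Rightarrow> 'a set" where
  "alternating_idem_algebra scale j B = generated_algebra scale
     {idem_word j \<epsilon> ps | \<epsilon> ps.
        set (\<epsilon> # map snd ps) \<subseteq> {- 1, 1} \<and> fst ` set ps \<subseteq> B \<and>
        distinct_adj (\<epsilon> # map snd ps) \<and> - 1 \<in> set (\<epsilon> # map snd ps)}"

end

theory Submission
  imports Defs
begin

text \<open>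
  Let \<open>G\<close> be the unital algebra generated by \<open>B \<union> C\<close>. The one fact behind both statements is that
  \<open>\<psi>\<close> splits at every occurrence of the idempotent: \<open>\<psi> (x * j * y) = \<psi> x * \<psi> y\<close> for all \<open>x\<close>, \<open>y\<close>
  in the algebra generated by \<open>G\<close> and \<open>j\<close> (\<open>Psi_split_at_j\<close>), while \<open>\<psi> = \<phi>\<close> on \<open>G\<close>
  (\<open>Psi_eq_phi\<close>).

  The splitting comes from reduced words, the alternating products of \<open>j\<close> with centred elements of
  \<open>G\<close>. They span the whole algebra, because \<open>j\<^sup>2 = j\<close> and every element of \<open>G\<close> is a scalar plus a
  centred one. Gluing two reduced words with a \<open>j\<close> in between gives a nonempty reduced word, on
  which \<open>\<phi>\<close> vanishes; hence \<open>\<phi>\<close> vanishes on every product in which \<open>j\<close> occurs. Inserting this into the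
  formula for \<open>\<phi>'\<close> kills almost all summands: \<open>\<psi>\<close> is \<open>0\<close> on a reduced word that contains a letter
  from \<open>G\<close>, and it is \<open>1\<close> on the remaining reduced words \<open>1\<close> and \<open>j\<close> (\<open>Psi_reduced\<close>). A glued word
  contains a letter from \<open>G\<close> iff one of its two parts does, so \<open>\<psi>\<close> is multiplicative across \<open>j\<close>.

  Monotone independence now amounts to pulling \<open>c \<in> C\<close> out of a product. If the left neighbour of
  \<open>c\<close> ends in \<open>j * r\<close> and its right neighbour begins with \<open>s * j\<close>, splitting at these two
  occurrences of \<open>j\<close> reduces the claim to \<open>\<psi> (r * c * s) = \<psi> c * \<psi> (r * s)\<close>
  (\<open>monotone_independent_criterion\<close>). In the corner \<open>j * x * j\<close> both \<open>r\<close> and \<open>s\<close> are \<open>1\<close> and there is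
  nothing to prove. An alternating word in which \<open>j\<close> occurs ends in \<open>j\<close> or in \<open>j * b * (1 - j)\<close>
  and begins with \<open>j\<close> or with \<open>(1 - j) * b * j\<close>, so
  \<open>r\<close> and \<open>s\<close> are \<open>1\<close>, \<open>b * (1 - j)\<close> or \<open>(1 - j) * b\<close>; expanding \<open>1 - j\<close> and splitting once more
  leaves values of \<open>\<phi>\<close> at \<open>b * c * b'\<close>, which freeness of \<open>B\<close> and \<open>C\<close> evaluates as
  \<open>\<phi> c * \<phi> (b * b')\<close>.
\<close>

section \<open>Subalgebras and freeness\<close>

lemma subalgebraD:
  assumes "subalgebra scale S"
  shows "module.subspace scale S" "x \<in> S \<Longrightarrow> y \<in> S \<Longrightarrow> x * y \<in> S"
  using assms by (auto simp: subalgebra_def)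

lemma unital_subalgebraD:
  assumes "unital_subalgebra scale S"
  shows "subalgebra scale S" "module.subspace scale S" "1 \<in> S" "x \<in> S \<Longrightarrow> y \<in> S \<Longrightarrow> x * y \<in> S"
  using assms by (auto simp: unital_subalgebra_def subalgebra_def)

lemma unital_subalgebra_prod_list:
  assumes "unital_subalgebra scale S" "set xs \<subseteq> S"
  shows "prod_list xs \<in> S"
  using assms(2) by (induction xs) (auto intro: unital_subalgebraD[OF assms(1)])

context unital_complex_algebra
begin

lemma generated_algebra_subalgebra: "subalgebra scale (generated_algebra scale X)"
  unfolding generated_algebra_def
  by (rule hull_in) (auto simp: subalgebra_def intro!: subspace_Inter)

lemma generated_algebra_superset: "X \<subseteq> generated_algebra scale X"
  unfolding generated_algebra_def by (rule hull_subset)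

lemma generated_algebra_minimal:
  "X \<subseteq> S \<Longrightarrow> subalgebra scale S \<Longrightarrow> generated_algebra scale X \<subseteq> S"
  unfolding generated_algebra_def by (rule hull_minimal)

lemma generated_unital_algebra_superset: "X \<subseteq> generated_unital_algebra scale X"
  unfolding generated_unital_algebra_def by (rule hull_subset)

lemma subspace_mult_right_vimage: "subspace S \<Longrightarrow> subspace {x. x * y \<in> S}"
  by (rule subspaceI) (auto simp: distrib_right scale_mult_left subspace_0 subspace_add subspace_scale)

lemma subspace_mult_left_vimage: "subspace S \<Longrightarrow> subspace {x. y * x \<in> S}"
  by (rule subspaceI) (auto simp: distrib_left mult_scale_right subspace_0 subspace_add subspace_scale)

lemma span_mult_left_closed:
  assumes "x \<in> span X" "\<And>v. v \<in> X \<Longrightarrow> y * v \<in> span X"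
  shows "y * x \<in> span X"
  using span_minimal[OF _ subspace_mult_left_vimage[OF subspace_span], of X y X] assms by auto

lemma span_mult_right_closed:
  assumes "x \<in> span X" "\<And>v. v \<in> X \<Longrightarrow> v * y \<in> span X"
  shows "x * y \<in> span X"
  using span_minimal[OF _ subspace_mult_right_vimage[OF subspace_span], of X y X] assms by auto

end

context infinitesimal_probability_space
begin

interpretation phi: Vector_Spaces.linear scale "(*)" \<phi> by (fact linear_phi)

definition center :: "'a \<Rightarrow> 'a" where
  "center a = a - scale (\<phi> a) 1"

lemma center_split: "a = scale (\<phi> a) 1 + center a"
  by (simp add: center_def)

lemma phi_center [simp]: "\<phi> (center a) = 0"
  by (simp add: center_def phi.diff phi.scale phi_one)

lemma center_in: "unital_subalgebra scale S \<Longrightarrow> a \<in> S \<Longrightarrow> center a \<in> S"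
  unfolding center_def
  by (blast intro: subspace_diff subspace_scale unital_subalgebraD)

text \<open>
  Expand \<open>b\<close>, \<open>c\<close>, \<open>b'\<close> into scalars and centred parts: freeness kills every term that
  contains the centred part of \<open>c\<close>. With \<open>b\<close> or \<open>b'\<close> equal to \<open>1\<close> this is the product rule for
  two factors.
\<close>

lemma free_factor_middle:
  assumes "freely_independent scale \<phi> (case_bool B C)" "b \<in> B" "b' \<in> B" "c \<in> C"
  shows "\<phi> (b * c * b') = \<phi> c * \<phi> (b * b')"
proof -
  have us: "unital_subalgebra scale B" "unital_subalgebra scale C"
    using assms(1) unfolding freely_independent_def by (metis bool.case)+
  have free: "\<phi> (prod_list as) = 0" if "centered_alternating \<phi> (case_bool B C) is as" for "is" as
    using assms(1) that unfolding freely_independent_def by blast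
  let ?b = "center b" and ?c = "center c" and ?b' = "center b'"
  have mem: "?b \<in> B" "?b' \<in> B" "?c \<in> C" using us assms center_in by auto
  have 1: "\<phi> (?b * ?c * ?b') = 0"
    using free[of "[True, False, True]" "[?b, ?c, ?b']"] mem
    by (simp add: centered_alternating_def less_Suc_eq mult.assoc numeral_2_eq_2 all_conj_distrib imp_disjL)
  have 2: "\<phi> (?b * ?c) = 0"
    using free[of "[True, False]" "[?b, ?c]"] mem
    by (simp add: centered_alternating_def less_Suc_eq)
  have 3: "\<phi> (?c * ?b') = 0"
    using free[of "[False, True]" "[?c, ?b']"] mem
    by (simp add: centered_alternating_def less_Suc_eq)
  have "b * ?c * b' = scale (\<phi> b * \<phi> b') ?c + scale (\<phi> b) (?c * ?b') + scale (\<phi> b') (?b * ?c) + ?b * ?c * ?b'"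
    by (subst center_split[of b], subst center_split[of b'])
      (simp add: algebra_simps scale_mult_left mult_scale_right)
  then have 0: "\<phi> (b * ?c * b') = 0"
    by (simp add: phi.add phi.scale 1 2 3)
  have "b * c * b' = scale (\<phi> c) (b * b') + b * ?c * b'"
    by (subst center_split[of c]) (simp add: algebra_simps scale_mult_left mult_scale_right)
  then show ?thesis by (simp add: phi.add phi.scale 0)
qed

end

section \<open>Reduced words\<close>

text \<open>
  Infinitesimal freeness from \<open>j\<close> involves \<open>B\<close> and \<open>C\<close> only through the algebra that they
  generate together; \<open>G\<close> stands for that algebra.
\<close>

locale infinitesimally_free_idempotent = infinitesimal_probability_space scale \<phi> \<phi>'
  for scale :: "complex \<Rightarrow> 'a::ring_1 \<Rightarrow> 'a" and \<phi> \<phi>' :: "'a \<Rightarrow> complex" +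
  fixes j :: 'a and G :: "'a set"
  assumes idem: "infinitesimal_idempotent \<phi> j"
    and phi'_j: "\<phi>' j \<noteq> 0"
    and inf_free: "infinitesimally_free scale \<phi> \<phi>' (case_bool G (generated_unital_algebra scale {j}))"
begin

interpretation phi: Vector_Spaces.linear scale "(*)" \<phi> by (fact linear_phi)
interpretation phi': Vector_Spaces.linear scale "(*)" \<phi>' by (fact linear_phi')

lemma jj [simp]: "j * j = j" "j * (j * x) = j * x"
  using idem by (simp_all add: infinitesimal_idempotent_def power2_eq_square mult.assoc[symmetric])

lemma phi_j [simp]: "\<phi> j = 0"
  using idem unfolding infinitesimal_idempotent_def by (metis le_refl power_one_right)

lemma G_unital: "unital_subalgebra scale G"
  using inf_free unfolding infinitesimally_free_def by (metis bool.case(1))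

definition \<Psi> :: "'a \<Rightarrow> complex" where
  "\<Psi> a = \<phi>' (a * j) / \<phi>' j"

lemma Psi_add: "\<Psi> (a + b) = \<Psi> a + \<Psi> b"
  by (simp add: \<Psi>_def distrib_right phi'.add add_divide_distrib)
lemma Psi_diff: "\<Psi> (a - b) = \<Psi> a - \<Psi> b"
  by (simp add: \<Psi>_def left_diff_distrib phi'.diff diff_divide_distrib)
lemma Psi_scale: "\<Psi> (scale r a) = r * \<Psi> a"
  by (simp add: \<Psi>_def scale_mult_left phi'.scale)
lemma Psi_zero [simp]: "\<Psi> 0 = 0"
  by (simp add: \<Psi>_def phi'.zero)
lemma Psi_one [simp]: "\<Psi> 1 = 1"
  by (simp add: \<Psi>_def phi'_j)

text \<open>
  The tag of a letter says which algebra it is taken from: \<open>True\<close> for \<open>G\<close>, \<open>False\<close> for the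
  algebra generated by \<open>j\<close>. The only letter of the second kind is \<open>j\<close> itself, which is already
  centred.
\<close>

definition reduced :: "(bool \<times> 'a) list \<Rightarrow> bool" where
  "reduced w \<longleftrightarrow> distinct_adj (map fst w) \<and>
     (\<forall>(i, a) \<in> set w. if i then a \<in> G \<and> \<phi> a = 0 else a = j)"

abbreviation word_prod :: "(bool \<times> 'a) list \<Rightarrow> 'a" where
  "word_prod w \<equiv> prod_list (map snd w)"

text \<open>
  This is the unital algebra generated by \<open>G\<close> and \<open>j\<close>. Defining it by a spanning set makes
  linear identities on it a matter of reduced words.
\<close>

definition word_span :: "'a set" where
  "word_span = span {word_prod w | w. reduced w}"

lemma subspace_word_span: "subspace word_span"
  by (simp add: word_span_def)

lemma word_prod_in_span: "reduced w \<Longrightarrow> word_prod w \<in> word_span"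
  unfolding word_span_def by (rule span_base) blast

lemma reduced_Nil: "reduced []"
  by (simp add: reduced_def)

lemma reduced_ConsD: "reduced (l # w) \<Longrightarrow> reduced w"
  by (auto simp: reduced_def distinct_adj_Cons)

lemma reduced_Cons_j: "reduced w \<Longrightarrow> w = [] \<or> fst (hd w) \<Longrightarrow> reduced ((False, j) # w)"
  by (cases w) (auto simp: reduced_def)

lemma reduced_Cons_G:
  "reduced w \<Longrightarrow> w = [] \<or> \<not> fst (hd w) \<Longrightarrow> a \<in> G \<Longrightarrow> \<phi> a = 0 \<Longrightarrow> reduced ((True, a) # w)"
  by (cases w) (auto simp: reduced_def)

lemma G_mult_reduced:
  assumes "reduced w" "w = [] \<or> \<not> fst (hd w)" "g \<in> G"
  shows "g * word_prod w \<in> word_span"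
proof -
  have "reduced ((True, center g) # w)"
    using assms by (intro reduced_Cons_G center_in[OF G_unital]) auto
  from word_prod_in_span[OF this] have 1: "center g * word_prod w \<in> word_span" by simp
  have "g * word_prod w = scale (\<phi> g) (word_prod w) + center g * word_prod w"
    by (subst center_split[of g]) (simp add: distrib_right scale_mult_left)
  then show ?thesis
    using 1 word_prod_in_span[OF assms(1)] by (simp add: subspace_word_span subspace_add subspace_scale)
qed

text \<open>
  A new letter in front of a reduced word either keeps it reduced or merges with the first
  letter, and a product of two elements of \<open>G\<close> is again a scalar plus a centred element.
\<close>

lemma word_span_left_mult:
  assumes "x \<in> word_span"
  shows "j * x \<in> word_span" "g \<in> G \<Longrightarrow> g * x \<in> word_span"
proof -
  have "j * word_prod w \<in> word_span" if w: "reduced w" for w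
  proof (cases "w = [] \<or> fst (hd w)")
    case True
    from word_prod_in_span[OF reduced_Cons_j[OF w True]] show ?thesis by simp
  next
    case False
    then obtain u where "w = (False, j) # u"
      using w by (cases w) (auto simp: reduced_def)
    then show ?thesis using word_prod_in_span[OF w] by simp
  qed
  then show "j * x \<in> word_span"
    using span_mult_left_closed[of x "{word_prod w | w. reduced w}" j] assms by (auto simp: word_span_def)
next
  assume g: "g \<in> G"
  have "g * word_prod w \<in> word_span" if w: "reduced w" for w
  proof (cases "w = [] \<or> \<not> fst (hd w)")
    case True
    then show ?thesis using G_mult_reduced[OF w] g by simp
  next
    case False
    then obtain a u where u: "w = (True, a) # u" "a \<in> G" "u = [] \<or> \<not> fst (hd u)"
      using w by (cases w; cases "tl w") (auto simp: reduced_def)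
    then have "(g * a) * word_prod u \<in> word_span"
      using g w by (intro G_mult_reduced unital_subalgebraD[OF G_unital]) (auto dest: reduced_ConsD)
    then show ?thesis using u by (simp add: mult.assoc)
  qed
  then show "g * x \<in> word_span"
    using span_mult_left_closed[of x "{word_prod w | w. reduced w}" g] assms by (auto simp: word_span_def)
qed

lemma one_in_word_span: "1 \<in> word_span"
  using word_prod_in_span[OF reduced_Nil] by simp

lemma j_in_word_span: "j \<in> word_span"
  using word_span_left_mult(1)[OF one_in_word_span] by simp

lemma G_in_word_span: "g \<in> G \<Longrightarrow> g \<in> word_span"
  using word_span_left_mult(2)[OF one_in_word_span] by simp

lemma word_span_unital: "unital_subalgebra scale word_span"
proof -
  have "word_prod w * y \<in> word_span" if "y \<in> word_span" "reduced w" for w y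
    using that(2)
  proof (induction w)
    case (Cons l w)
    then have "word_prod w * y \<in> word_span" by (blast dest: reduced_ConsD)
    moreover have "snd l = j \<or> snd l \<in> G"
      using Cons.prems by (cases l) (auto simp: reduced_def split: if_splits)
    ultimately show ?case
      using word_span_left_mult[of "word_prod w * y"] by (elim disjE) (simp_all add: mult.assoc)
  qed (simp add: that(1))
  then have "x * y \<in> word_span" if "x \<in> word_span" "y \<in> word_span" for x y
    using span_minimal[OF _ subspace_mult_right_vimage[OF subspace_word_span], of "{word_prod w | w. reduced w}" y]
      that unfolding word_span_def by blast
  then show ?thesis
    by (simp add: unital_subalgebra_def subalgebra_def subspace_word_span one_in_word_span)
qed

lemmas word_span_mult = unital_subalgebraD(4)[OF word_span_unital]

lemma reduced_centered_alternating:
  assumes "reduced w" "w \<noteq> []"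
  shows "centered_alternating \<phi> (case_bool G (generated_unital_algebra scale {j}))
           (map fst w) (map snd w)"
proof -
  have "j \<in> generated_unital_algebra scale {j}"
    using generated_unital_algebra_superset by blast
  then have "snd l \<in> case_bool G (generated_unital_algebra scale {j}) (fst l) \<and> \<phi> (snd l) = 0"
    if "l \<in> set w" for l
    using assms(1) that by (cases l) (force simp: reduced_def split: if_splits bool.splits)
  then show ?thesis
    using assms by (simp add: centered_alternating_def reduced_def)
qed

lemma phi_reduced: "reduced w \<Longrightarrow> w \<noteq> [] \<Longrightarrow> \<phi> (word_prod w) = 0"
  using reduced_centered_alternating inf_free unfolding infinitesimally_free_def by blast

lemma phi'_reduced:
  "reduced w \<Longrightarrow> w \<noteq> [] \<Longrightarrow> \<phi>' (word_prod w) =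
     (\<Sum>k<length w. \<phi>' (snd (w ! k)) * \<phi> (prod_list (take k (map snd w) @ drop (Suc k) (map snd w))))"
  using reduced_centered_alternating[of w] inf_free unfolding infinitesimally_free_def by simp

text \<open>
  As \<open>j\<^sup>2 = j\<close>, a letter \<open>j\<close> next to another \<open>j\<close> may be dropped. This prepares for gluing words
  at a \<open>j\<close>.
\<close>

lemma reduced_absorb_left:
  assumes "reduced w"
  obtains u where "reduced u" "u = [] \<or> fst (hd u)" "j * word_prod w = j * word_prod u"
    "True \<in> fst ` set u \<longleftrightarrow> True \<in> fst ` set w"
proof (cases "w = [] \<or> fst (hd w)")
  case False
  then obtain u where u: "w = (False, j) # u" "u = [] \<or> fst (hd u)"
    using assms by (cases w; cases "tl w") (auto simp: reduced_def)
  show ?thesis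
    by (rule that[of u]) (use u assms in \<open>auto dest: reduced_ConsD\<close>)
qed (use assms that in blast)

lemma reduced_absorb_right:
  assumes "reduced w"
  obtains u where "reduced u" "u = [] \<or> fst (last u)" "word_prod w * j = word_prod u * j"
    "True \<in> fst ` set u \<longleftrightarrow> True \<in> fst ` set w"
proof (cases "w = [] \<or> fst (last w)")
  case False
  then obtain u where u: "w = u @ [(False, j)]"
    using assms by (cases w rule: rev_cases) (auto simp: reduced_def)
  then have "reduced u" "u = [] \<or> fst (last u)"
    using assms by (cases "u = []"; auto simp: reduced_def distinct_adj_append_iff last_map)+
  then show ?thesis
    by (intro that[of u]) (use u in \<open>auto simp: mult.assoc\<close>)
qed (use assms that in blast)

lemma reduced_join:
  assumes "reduced u" "u = [] \<or> fst (last u)" "reduced v" "v = [] \<or> fst (hd v)"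
  shows "reduced (u @ (False, j) # v)"
  using assms by (cases "u = []"; cases "v = []")
    (auto simp: reduced_def distinct_adj_append_iff distinct_adj_Cons last_map hd_map)

text \<open>
  Gluing at \<open>j\<close> never merges letters from \<open>G\<close>, so no letter from \<open>G\<close> can be lost.
\<close>

lemma reduced_around_j:
  assumes "reduced w" "reduced w'"
  obtains u where "reduced u" "u \<noteq> []" "word_prod w * j * word_prod w' = word_prod u"
    "True \<in> fst ` set u \<longleftrightarrow> True \<in> fst ` set w \<or> True \<in> fst ` set w'"
proof -
  obtain u where u: "reduced u" "u = [] \<or> fst (last u)" "word_prod w * j = word_prod u * j"
    "True \<in> fst ` set u \<longleftrightarrow> True \<in> fst ` set w"
    using reduced_absorb_right[OF assms(1)] .
  obtain v where v: "reduced v" "v = [] \<or> fst (hd v)" "j * word_prod w' = j * word_prod v"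
    "True \<in> fst ` set v \<longleftrightarrow> True \<in> fst ` set w'"
    using reduced_absorb_left[OF assms(2)] .
  have "word_prod w * j * word_prod w' = word_prod (u @ (False, j) # v)"
    using u(3) v(3) by (simp add: mult.assoc)
  moreover have "reduced (u @ (False, j) # v)" 
    using u v by (intro reduced_join)
  ultimately show ?thesis
    using u v by (intro that[of "u @ (False, j) # v"]) auto
qed

lemma bilinear_on_word_span:
  assumes "x \<in> word_span" "y \<in> word_span"
    and "\<And>y. subspace {x. P x y}" "\<And>x. subspace {y. P x y}"
    and "\<And>w w'. reduced w \<Longrightarrow> reduced w' \<Longrightarrow> P (word_prod w) (word_prod w')"
  shows "P x y"
proof -
  have "P x (word_prod w')" if "reduced w'" for w'
    using span_minimal[OF _ assms(3)[of "word_prod w'"], of "{word_prod w | w. reduced w}"] assms(1,5) that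
    unfolding word_span_def by blast
  then show ?thesis
    using span_minimal[OF _ assms(4)[of x], of "{word_prod w | w. reduced w}"] assms(2)
    unfolding word_span_def by blast
qed

section \<open>The functional splits at the idempotent\<close>

lemma phi_around_j:
  assumes "x \<in> word_span" "y \<in> word_span"
  shows "\<phi> (x * j * y) = 0"
proof (rule bilinear_on_word_span[OF assms, where P = "\<lambda>x y. \<phi> (x * j * y) = 0"])
  show "subspace {x. \<phi> (x * j * y) = 0}" for y
    by (rule subspaceI) (auto simp: distrib_right scale_mult_left phi.add phi.scale phi.zero)
  show "subspace {y. \<phi> (x * j * y) = 0}" for x
    by (rule subspaceI) (auto simp: distrib_left mult_scale_right phi.add phi.scale phi.zero)
  show "\<phi> (word_prod w * j * word_prod w') = 0" if w: "reduced w" "reduced w'" for w w'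
    using reduced_around_j[OF w] phi_reduced by metis
qed

lemma phi_prod_with_j:
  assumes "set xs \<subseteq> word_span" "j \<in> set xs"
  shows "\<phi> (prod_list xs) = 0"
proof -
  obtain ys zs where "xs = ys @ j # zs" using split_list[OF assms(2)] by blast
  then show ?thesis
    using assms(1) phi_around_j[of "prod_list ys" "prod_list zs"]
    by (simp add: unital_subalgebra_prod_list[OF word_span_unital] mult.assoc)
qed

lemma reduced_letters_in_span: "reduced w \<Longrightarrow> set (map snd w) \<subseteq> word_span"
  by (auto simp: reduced_def j_in_word_span G_in_word_span split: if_splits)

text \<open>
  Write the word followed by \<open>j\<close> as a reduced word \<open>u j\<close>. If \<open>u\<close> contains \<open>j\<close>, then each
  summand of the formula for \<open>\<phi>'\<close> has at least one \<open>j\<close> left under \<open>\<phi>\<close> and vanishes. Otherwise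
  \<open>u\<close> has at most one letter: a single centred \<open>g\<close> contributes
  \<open>\<phi>' g * \<phi> j + \<phi>' j * \<phi> g = 0\<close>, and the empty \<open>u\<close> gives \<open>\<phi>' j\<close>.
\<close>

lemma Psi_reduced:
  assumes "reduced w"
  shows "\<Psi> (word_prod w) = (if True \<in> fst ` set w then 0 else 1)"
proof -
  obtain u where u: "reduced u" "u = [] \<or> fst (last u)" "word_prod w * j = word_prod u * j"
    "True \<in> fst ` set u \<longleftrightarrow> True \<in> fst ` set w"
    using reduced_absorb_right[OF assms] .
  let ?v = "u @ [(False, j)]"
  have v: "reduced ?v" using reduced_join[OF u(1,2) reduced_Nil] by simp
  have Psi: "\<Psi> (word_prod w) = \<phi>' (word_prod ?v) / \<phi>' j"
    using u(3) by (simp add: \<Psi>_def)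
  show ?thesis
  proof (cases "False \<in> fst ` set u")
    case True
    then have j: "j \<in> set (map snd u)"
      using u(1) by (force simp: reduced_def)
    have "\<phi> (prod_list (take k (map snd ?v) @ drop (Suc k) (map snd ?v))) = 0"
      if "k < length ?v" for k
    proof (rule phi_prod_with_j)
      show "set (take k (map snd ?v) @ drop (Suc k) (map snd ?v)) \<subseteq> word_span"
        using reduced_letters_in_span[OF v] by (simp only: set_append) (blast dest: in_set_takeD in_set_dropD)
      show "j \<in> set (take k (map snd ?v) @ drop (Suc k) (map snd ?v))"
        using that j by (cases "k = length u") auto
    qed
    then have "\<phi>' (word_prod ?v) = 0"
      by (subst phi'_reduced[OF v]) (simp_all del: map_append)
    moreover have "u \<noteq> []" using True by auto
    then have "fst (last u)" "last u \<in> set u" using u(2) by simp_all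
    then have "True \<in> fst ` set u" by (metis (full_types) imageI)
    ultimately show ?thesis using u(4) Psi by simp
  next
    case False
    show ?thesis
    proof (cases u)
      case Nil
      then show ?thesis using u(4) Psi phi'_j by simp
    next
      case (Cons l u')
      then have "u' = []" using False u(1) by (cases u') (auto simp: reduced_def)
      then obtain g where g: "u = [(True, g)]" "\<phi> g = 0"
        using Cons u(1) False by (cases l) (auto simp: reduced_def)
      then have "\<phi>' (word_prod ?v) = 0" by (subst phi'_reduced[OF v]) simp_all
      then show ?thesis using u(4) Psi g by simp
    qed
  qed
qed

text \<open>
  On reduced words \<open>\<Psi>\<close> only tells whether a letter from \<open>G\<close> occurs, and gluing at \<open>j\<close> preserves
  the answer.
\<close>

lemma Psi_split_at_j:
  assumes "x \<in> word_span" "y \<in> word_span"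
  shows "\<Psi> (x * j * y) = \<Psi> x * \<Psi> y"
proof (rule bilinear_on_word_span[OF assms, where P = "\<lambda>x y. \<Psi> (x * j * y) = \<Psi> x * \<Psi> y"])
  show "subspace {x. \<Psi> (x * j * y) = \<Psi> x * \<Psi> y}" for y
    by (rule subspaceI) (auto simp: distrib_right scale_mult_left Psi_add Psi_scale)
  show "subspace {y. \<Psi> (x * j * y) = \<Psi> x * \<Psi> y}" for x
    by (rule subspaceI) (auto simp: distrib_left mult_scale_right Psi_add Psi_scale)
  show "\<Psi> (word_prod w * j * word_prod w') = \<Psi> (word_prod w) * \<Psi> (word_prod w')"
    if w: "reduced w" "reduced w'" for w w'
  proof -
    obtain u where "reduced u" "word_prod w * j * word_prod w' = word_prod u"
      "True \<in> fst ` set u \<longleftrightarrow> True \<in> fst ` set w \<or> True \<in> fst ` set w'"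
      using reduced_around_j[OF w] by metis
    then show ?thesis using w by (auto simp: Psi_reduced)
  qed
qed

lemma Psi_eq_phi:
  assumes "g \<in> G"
  shows "\<Psi> g = \<phi> g"
proof -
  have "reduced [(True, center g)]"
    using assms center_in[OF G_unital] by (simp add: reduced_def)
  from Psi_reduced[OF this] have "\<Psi> (center g) = 0" by simp
  then show ?thesis
    using arg_cong[OF center_split[of g], of \<Psi>] by (simp add: Psi_add Psi_scale)
qed

section \<open>A criterion for monotone independence\<close>

text \<open>
  Splitting at the last \<open>j\<close> of \<open>p\<close> and the first \<open>j\<close> of \<open>q\<close> isolates \<open>r * c * s\<close>, resp.
  \<open>r * s\<close>; the two outer factors are the same on both sides.
\<close>

lemma Psi_factor_middle_span:
  assumes "X \<subseteq> word_span" "Y \<subseteq> word_span" "c \<in> word_span"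
    and factor: "\<And>r s. r \<in> X \<Longrightarrow> s \<in> Y \<Longrightarrow> \<Psi> (r * c * s) = \<Psi> c * \<Psi> (r * s)"
    and p: "p \<in> span {m * j * r | m r. m \<in> word_span \<and> r \<in> X}" (is "_ \<in> span ?L")
    and q: "q \<in> span {s * j * m | m s. m \<in> word_span \<and> s \<in> Y}" (is "_ \<in> span ?R")
  shows "\<Psi> (p * c * q) = \<Psi> c * \<Psi> (p * q)"
proof -
  have 1: "\<Psi> (p * c * q) = \<Psi> c * \<Psi> (p * q)" if pL: "p \<in> ?L" and qR: "q \<in> ?R" for p q
  proof -
    obtain m r m' s where eq: "p = m * j * r" "q = s * j * m'"
      and mem: "m \<in> word_span" "m' \<in> word_span" "r \<in> word_span" "s \<in> word_span" "r \<in> X" "s \<in> Y"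
      using pL qR assms(1,2) by blast
    have rs: "\<Psi> (m * j * (t * j * m')) = \<Psi> m * \<Psi> t * \<Psi> m'" if t: "t \<in> word_span" for t
    proof -
      have "t * j * m' \<in> word_span" by (intro word_span_mult t j_in_word_span mem)
      from Psi_split_at_j[OF mem(1) this] Psi_split_at_j[OF t mem(2)] show ?thesis by simp
    qed
    have "p * c * q = m * j * ((r * c * s) * j * m')" "p * q = m * j * ((r * s) * j * m')"
      by (simp_all add: eq mult.assoc)
    moreover have "r * c * s \<in> word_span" "r * s \<in> word_span" by (intro word_span_mult mem assms(3))+
    ultimately have "\<Psi> (p * c * q) = \<Psi> m * \<Psi> (r * c * s) * \<Psi> m'"
      "\<Psi> (p * q) = \<Psi> m * \<Psi> (r * s) * \<Psi> m'"
      by (simp_all only: rs)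
    then show ?thesis using factor[OF mem(5,6)] by simp
  qed
  have "subspace {p. \<Psi> (p * c * q) = \<Psi> c * \<Psi> (p * q)}" for q
    by (rule subspaceI) (auto simp: distrib_right distrib_left scale_mult_left Psi_add Psi_scale)
  from span_minimal[OF _ this, of ?L] have 2: "\<Psi> (p * c * q) = \<Psi> c * \<Psi> (p * q)" if "q \<in> ?R" for q
    using 1[OF _ that] p by blast
  have "subspace {q. \<Psi> (p * c * q) = \<Psi> c * \<Psi> (p * q)}"
    by (rule subspaceI) (auto simp: distrib_left mult_scale_right Psi_add Psi_scale)
  from span_minimal[OF _ this, of ?R] show ?thesis
    using 2 q by blast
qed

text \<open>
  Being a left (resp. right) ideal lets the neighbour of \<open>c\<close> absorb the rest of the product on
  its side.
\<close>

lemma span_left_ideal: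
  assumes "X \<subseteq> word_span"
  defines "L \<equiv> {m * j * r | m r. m \<in> word_span \<and> r \<in> X}"
  shows "span L \<subseteq> word_span" "x \<in> word_span \<Longrightarrow> y \<in> span L \<Longrightarrow> x * y \<in> span L"
proof -
  show "span L \<subseteq> word_span"
    using assms by (intro span_minimal[OF _ subspace_word_span]) (auto intro!: word_span_mult j_in_word_span)
  assume "x \<in> word_span" "y \<in> span L"
  have "x * l \<in> span L" if l: "l \<in> L" for l
  proof (rule span_base)
    obtain m r where "l = m * j * r" "m \<in> word_span" "r \<in> X" using l by (auto simp: L_def)
    then have "x * l = (x * m) * j * r" "x * m \<in> word_span" "r \<in> X"
      using \<open>x \<in> word_span\<close> by (simp_all add: mult.assoc word_span_mult)
    then show "x * l \<in> L" unfolding L_def by blast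
  qed
  with \<open>y \<in> span L\<close> show "x * y \<in> span L" by (rule span_mult_left_closed)
qed

lemma span_right_ideal:
  assumes "Y \<subseteq> word_span"
  defines "R \<equiv> {s * j * m | m s. m \<in> word_span \<and> s \<in> Y}"
  shows "span R \<subseteq> word_span" "x \<in> word_span \<Longrightarrow> y \<in> span R \<Longrightarrow> y * x \<in> span R"
proof -
  show "span R \<subseteq> word_span"
    using assms by (intro span_minimal[OF _ subspace_word_span]) (auto intro!: word_span_mult j_in_word_span)
  assume "x \<in> word_span" "y \<in> span R"
  have "l * x \<in> span R" if l: "l \<in> R" for l
  proof (rule span_base)
    obtain m s where "l = s * j * m" "m \<in> word_span" "s \<in> Y" using l by (auto simp: R_def)
    then have "l * x = s * j * (m * x)" "m * x \<in> word_span" "s \<in> Y"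
      using \<open>x \<in> word_span\<close> by (simp_all add: mult.assoc word_span_mult)
    then show "l * x \<in> R" unfolding R_def by blast
  qed
  with \<open>y \<in> span R\<close> show "y * x \<in> span R" by (rule span_mult_right_closed)
qed

text \<open>
  \<open>X\<close> holds what may follow the last \<open>j\<close> of an element of \<open>D\<close>, and \<open>Y\<close> what may precede the
  first one.
\<close>

lemma monotone_independent_criterion:
  assumes "X \<subseteq> word_span" "Y \<subseteq> word_span" "1 \<in> X" "1 \<in> Y" "C \<subseteq> G" "subalgebra scale C" "subalgebra scale D"
    and factor: "\<And>r s c. r \<in> X \<Longrightarrow> s \<in> Y \<Longrightarrow> c \<in> C \<Longrightarrow> \<Psi> (r * c * s) = \<Psi> c * \<Psi> (r * s)"
    and DL: "D \<subseteq> span {m * j * r | m r. m \<in> word_span \<and> r \<in> X}" (is "_ \<subseteq> span ?L")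
    and DR: "D \<subseteq> span {s * j * m | m s. m \<in> word_span \<and> s \<in> Y}" (is "_ \<subseteq> span ?R")
  shows "monotone_independent scale \<Psi> D C"
  unfolding monotone_independent_def
proof (intro conjI allI impI)
  fix as k
  assume as: "set as \<subseteq> D \<union> C \<and> k < length as \<and> as ! k \<in> C \<and>
    (0 < k \<longrightarrow> as ! (k - 1) \<in> D) \<and> (Suc k < length as \<longrightarrow> as ! Suc k \<in> D)"
  define c where "c = as ! k"
  define x where "x = prod_list (take k as)"
  define y where "y = prod_list (drop (Suc k) as)"
  have c: "c \<in> C" "c \<in> word_span" using as assms(5) by (auto simp: c_def intro: G_in_word_span)
  have "D \<subseteq> word_span" using DL span_left_ideal(1)[OF assms(1)] by blast
  then have letters: "set as \<subseteq> word_span" using as assms(5) G_in_word_span by blast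
  have prod_in: "prod_list zs \<in> word_span" if "set zs \<subseteq> set as" for zs
    using that letters by (intro unital_subalgebra_prod_list[OF word_span_unital]) auto
  have xM: "x \<in> word_span" and yM: "y \<in> word_span"
    unfolding x_def y_def by (intro prod_in set_take_subset set_drop_subset)+
  have "j = 1 * j * 1" by simp
  then have jL: "j \<in> span ?L" and jR: "j \<in> span ?R"
    using assms(3,4) one_in_word_span by (blast intro: span_base)+
  have L: "j * x \<in> span ?L"
  proof (cases k)
    case 0
    then show ?thesis using jL by (simp add: x_def)
  next
    case (Suc k')
    then have "x = prod_list (take k' as) * as ! k'"
      using as by (simp add: x_def take_Suc_conv_app_nth)
    then have "j * x = (j * prod_list (take k' as)) * as ! k'"
      by (simp add: mult.assoc)
    moreover have "as ! k' \<in> span ?L" using as Suc DL by auto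
    moreover have "j * prod_list (take k' as) \<in> word_span"
      by (intro word_span_mult j_in_word_span prod_in set_take_subset)
    ultimately show ?thesis using span_left_ideal(2)[OF assms(1)] by simp
  qed
  have R: "y * j \<in> span ?R"
  proof (cases "Suc k < length as")
    case False
    then show ?thesis using jR by (simp add: y_def)
  next
    case True
    then have "y * j = as ! Suc k * (prod_list (drop (Suc (Suc k)) as) * j)"
      by (simp add: y_def Cons_nth_drop_Suc[symmetric] mult.assoc)
    moreover have "as ! Suc k \<in> span ?R" using as True DR by auto
    moreover have "prod_list (drop (Suc (Suc k)) as) * j \<in> word_span"
      by (intro word_span_mult j_in_word_span prod_in set_drop_subset)
    ultimately show ?thesis using span_right_ideal(2)[OF assms(2)] by simp
  qed
  \<comment> \<open>Padding with \<open>j\<close> does not change \<open>\<Psi>\<close>. It makes \<open>c\<close> have a neighbour on both sides even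
    if it is the first or the last factor.\<close>
  have pad: "\<Psi> (j * z * j) = \<Psi> z" if "z \<in> word_span" for z
    using Psi_split_at_j[of 1 "z * j"] Psi_split_at_j[of z 1] that
    by (simp add: one_in_word_span j_in_word_span word_span_mult mult.assoc)
  have "\<Psi> (x * c * y) = \<Psi> ((j * x) * c * (y * j))"
    using pad[of "x * c * y"] xM yM c by (simp add: word_span_mult mult.assoc)
  also have "\<dots> = \<Psi> c * \<Psi> ((j * x) * (y * j))"
    using Psi_factor_middle_span[OF assms(1,2) c(2) factor[OF _ _ c(1)] L R] .
  also have "\<dots> = \<Psi> c * \<Psi> (x * y)"
    using pad[of "x * y"] xM yM by (simp add: word_span_mult mult.assoc)
  finally have "\<Psi> (x * c * y) = \<Psi> c * \<Psi> (x * y)" .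
  moreover have "prod_list as = x * c * y"
    using as by (subst id_take_nth_drop[of k as]) (simp_all add: x_def y_def c_def mult.assoc)
  moreover have "prod_list (as[k := scale (\<Psi> c) 1]) = scale (\<Psi> c) (x * y)"
    using as by (simp add: upd_conv_take_nth_drop x_def y_def scale_mult_left mult_scale_right)
  ultimately show "\<Psi> (prod_list as) = \<Psi> (prod_list (as[k := scale (\<Psi> (as ! k)) 1]))"
    by (simp add: c_def[symmetric] Psi_scale)
qed (use assms in auto)

section \<open>The corner and the alternating algebra\<close>

lemma idem_word_in_word_span:
  assumes "B \<subseteq> word_span" "fst ` set ps \<subseteq> B"
  shows "idem_word j \<epsilon> ps \<in> word_span"
proof -
  have s: "signed_idem j \<epsilon> \<in> word_span" for \<epsilon>
    by (simp add: signed_idem_def j_in_word_span one_in_word_span subspace_word_span subspace_diff)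
  show ?thesis
    using assms(2) by (induction ps arbitrary: \<epsilon>) (use assms(1) in \<open>auto intro!: word_span_mult s\<close>)
qed

lemma monotone_independent_corner:
  assumes "B \<subseteq> G" "C \<subseteq> G" "subalgebra scale C"
  shows "monotone_independent scale \<Psi> {j * x * j | x. x \<in> idem_algebra scale j B} C"
proof (rule monotone_independent_criterion[where X = "{1}" and Y = "{1}"])
  let ?J = "idem_algebra scale j B"
  let ?D = "{j * x * j | x. x \<in> ?J}"
  have J: "subalgebra scale ?J"
    unfolding idem_algebra_def by (rule generated_algebra_subalgebra)
  have "j \<in> ?J"
    unfolding idem_algebra_def
    by (rule subsetD[OF generated_algebra_superset], rule insertI2, rule CollectI,
        rule exI[of _ "- 1"], rule exI[of _ "[]"]) (simp add: signed_idem_def)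
  show "subalgebra scale ?D"
    unfolding subalgebra_def
  proof (intro conjI ballI)
    have "?D = (\<lambda>x. j * x * j) ` ?J" by blast
    moreover have "subspace ((\<lambda>x. j * x * j) ` ?J)"
    proof (rule subspaceI)
      show "0 \<in> (\<lambda>x. j * x * j) ` ?J"
        using subspace_0[OF subalgebraD(1)[OF J]] by force
      fix x y r
      assume "x \<in> (\<lambda>x. j * x * j) ` ?J"
      then obtain x' where x: "x = j * x' * j" "x' \<in> ?J" by blast
      then show "scale r x \<in> (\<lambda>x. j * x * j) ` ?J"
        using subspace_scale[OF subalgebraD(1)[OF J]]
        by (intro image_eqI[of _ _ "scale r x'"]) (simp_all add: scale_mult_left mult_scale_right)
      assume "y \<in> (\<lambda>x. j * x * j) ` ?J"
      then obtain y' where y: "y = j * y' * j" "y' \<in> ?J" by blast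
      show "x + y \<in> (\<lambda>x. j * x * j) ` ?J"
        using subspace_add[OF subalgebraD(1)[OF J]] x y
        by (intro image_eqI[of _ _ "x' + y'"]) (simp_all add: algebra_simps)
    qed
    ultimately show "subspace ?D" by simp
    fix x y
    assume "x \<in> ?D" "y \<in> ?D"
    then obtain x' y' where xy: "x = j * x' * j" "y = j * y' * j" "x' \<in> ?J" "y' \<in> ?J" by blast
    then have "x * y = j * (x' * j * y') * j" by (simp add: mult.assoc)
    moreover have "x' * j * y' \<in> ?J" using xy \<open>j \<in> ?J\<close> by (intro subalgebraD(2)[OF J])
    ultimately show "x * y \<in> ?D" by blast
  qed
  have BM: "B \<subseteq> word_span" using assms(1) G_in_word_span by blast
  have JM: "?J \<subseteq> word_span"
    unfolding idem_algebra_def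
    by (rule generated_algebra_minimal)
      (auto simp: one_in_word_span unital_subalgebraD(1)[OF word_span_unital] intro: idem_word_in_word_span[OF BM])
  show "?D \<subseteq> span {m * j * r | m r. m \<in> word_span \<and> r \<in> {1}}"
  proof
    fix d assume "d \<in> ?D"
    then obtain x where "d = (j * x) * j * 1" "j * x \<in> word_span" using JM j_in_word_span word_span_mult by auto
    then show "d \<in> span {m * j * r | m r. m \<in> word_span \<and> r \<in> {1}}" by (intro span_base) blast
  qed
  show "?D \<subseteq> span {s * j * m | m s. m \<in> word_span \<and> s \<in> {1}}"
  proof
    fix d assume "d \<in> ?D"
    then obtain x where "d = 1 * j * (x * j)" "x * j \<in> word_span" using JM j_in_word_span word_span_mult
      by (auto simp: mult.assoc)
    then show "d \<in> span {s * j * m | m s. m \<in> word_span \<and> s \<in> {1}}" by (intro span_base) blast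
  qed
qed (use assms one_in_word_span in auto)

text \<open>
  Consecutive signs differ, so at most one \<open>1 - j\<close> follows the last \<open>j\<close>. The condition that
  \<open>j\<close> occurs excludes the lone letter \<open>1 - j\<close>.
\<close>

lemma alternating_idem_word_ending:
  assumes "B \<subseteq> word_span" "fst ` set ps \<subseteq> B"
    and "set (\<epsilon> # map snd ps) \<subseteq> {- 1, 1}" "distinct_adj (\<epsilon> # map snd ps)" "- 1 \<in> set (\<epsilon> # map snd ps)"
  shows "idem_word j \<epsilon> ps \<in> {m * j * r | m r. m \<in> word_span \<and> r \<in> insert 1 {b * (1 - j) | b. b \<in> B}}"
    (is "_ \<in> ?L")
  using assms(2-)
proof (induction ps arbitrary: \<epsilon>)
  case Nil
  then have "idem_word j \<epsilon> [] = 1 * j * 1" by (simp add: signed_idem_def)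
  then show ?case using one_in_word_span by blast
next
  case (Cons p ps)
  obtain b \<epsilon>' where p: "p = (b, \<epsilon>')" by (cases p)
  have b: "b \<in> B" using Cons.prems p by simp
  show ?case
  proof (cases "- 1 \<in> set (\<epsilon>' # map snd ps)")
    case True
    have "idem_word j \<epsilon>' ps \<in> ?L"
      by (rule Cons.IH) (use Cons.prems True p in auto)
    then obtain m r where mr: "idem_word j \<epsilon>' ps = m * j * r" "m \<in> word_span"
      "r \<in> insert 1 {b * (1 - j) | b. b \<in> B}" by blast
    have "signed_idem j \<epsilon> \<in> word_span" using idem_word_in_word_span[OF assms(1), of "[]" \<epsilon>] by simp
    then have "signed_idem j \<epsilon> * b * m \<in> word_span" using b assms(1) mr by (auto intro: word_span_mult)
    moreover have "idem_word j \<epsilon> (p # ps) = (signed_idem j \<epsilon> * b * m) * j * r"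
      using mr by (simp add: p mult.assoc)
    ultimately show ?thesis using mr(3) by blast
  next
    case False
    then have "\<epsilon> = - 1" "\<epsilon>' = 1" using Cons.prems p by auto
    moreover have "ps = []" using Cons.prems p False by (cases ps) auto
    ultimately have "idem_word j \<epsilon> (p # ps) = 1 * j * (b * (1 - j))"
      by (simp add: p signed_idem_def mult.assoc)
    then show ?thesis using b one_in_word_span by blast
  qed
qed

lemma alternating_idem_word_beginning:
  assumes "B \<subseteq> word_span" "fst ` set ps \<subseteq> B"
    and "set (\<epsilon> # map snd ps) \<subseteq> {- 1, 1}" "distinct_adj (\<epsilon> # map snd ps)" "- 1 \<in> set (\<epsilon> # map snd ps)"
  shows "idem_word j \<epsilon> ps \<in> {s * j * m | m s. m \<in> word_span \<and> s \<in> insert 1 {(1 - j) * b | b. b \<in> B}}"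
    (is "_ \<in> ?R")
proof -
  have minus: "\<exists>m\<in>word_span. idem_word j (- 1) qs = j * m" if "fst ` set qs \<subseteq> B" for qs
  proof (cases qs)
    case Nil
    then show ?thesis using one_in_word_span by (intro bexI[of _ 1]) (simp_all add: signed_idem_def)
  next
    case (Cons q qs')
    then have "idem_word j (- 1) qs = j * (fst q * idem_word j (snd q) qs')"
      by (simp add: signed_idem_def mult.assoc)
    moreover have "fst q * idem_word j (snd q) qs' \<in> word_span"
      using that Cons assms(1) by (intro word_span_mult idem_word_in_word_span[OF assms(1)]) auto
    ultimately show ?thesis by blast
  qed
  show ?thesis
  proof (cases "\<epsilon> = - 1")
    case True
    then obtain m where "idem_word j \<epsilon> ps = 1 * j * m" "m \<in> word_span" using minus[OF assms(2)] by auto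
    then show ?thesis by blast
  next
    case False
    then obtain b qs where ps: "ps = (b, - 1) # qs" "\<epsilon> = 1"
      using assms(3-5) by (cases ps) auto
    then obtain m where "idem_word j (- 1) qs = j * m" "m \<in> word_span" using minus[of qs] assms(2) by auto
    then have "idem_word j \<epsilon> ps = ((1 - j) * b) * j * m" "m \<in> word_span"
      by (simp_all add: ps signed_idem_def mult.assoc)
    then show ?thesis using ps assms(2) by auto
  qed
qed

text \<open>
  The factors \<open>1 - j\<close> turn products into covariances such as \<open>\<phi> (b * c) - \<phi> b * \<phi> c\<close>. By
  freeness, those between \<open>B\<close> and \<open>C\<close> vanish, and with both factors present the value is
  \<open>\<phi> c * (\<phi> (b * b') - \<phi> b * \<phi> b')\<close>.
\<close>

lemma Psi_factor_middle_free:
  assumes "freely_independent scale \<phi> (case_bool B C)" "B \<subseteq> G" "C \<subseteq> G"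
    and "r \<in> insert 1 {b * (1 - j) | b. b \<in> B}" "s \<in> insert 1 {(1 - j) * b | b. b \<in> B}" "c \<in> C"
  shows "\<Psi> (r * c * s) = \<Psi> c * \<Psi> (r * s)"
proof -
  have "1 \<in> B"
    using assms(1) unfolding freely_independent_def by (metis bool.case(1) unital_subalgebraD(3))
  have fac: "\<phi> (b * (c * b')) = \<phi> c * \<phi> (b * b')" if "b \<in> B" "b' \<in> B" for b b'
    using free_factor_middle[OF assms(1) that assms(6)] by (simp add: mult.assoc)
  then have facG: "\<Psi> (b * (c * b')) = \<Psi> c * \<Psi> (b * b')" if "b \<in> B" "b' \<in> B" for b b'
    using that assms(2,3,6) Psi_eq_phi unital_subalgebraD(4)[OF G_unital] by (metis subsetD)
  have facL: "\<Psi> (b * c) = \<Psi> c * \<Psi> b" and facR: "\<Psi> (c * b) = \<Psi> c * \<Psi> b" if "b \<in> B" for b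
    using facG[OF that \<open>1 \<in> B\<close>] facG[OF \<open>1 \<in> B\<close> that] by simp_all
  have BM: "b \<in> word_span" if "b \<in> B" for b using that assms(2) G_in_word_span by blast
  have cM: "c \<in> word_span" using assms(3,6) G_in_word_span by blast
  have perp: "1 - j \<in> word_span" by (simp add: j_in_word_span one_in_word_span subspace_word_span subspace_diff)
  have cut: "\<Psi> (x * (1 - j) * y) = \<Psi> (x * y) - \<Psi> x * \<Psi> y" if "x \<in> word_span" "y \<in> word_span" for x y
    using Psi_split_at_j[OF that] by (simp add: left_diff_distrib right_diff_distrib Psi_diff)
  have cut2: "\<Psi> (x * (1 - j) * y * ((1 - j) * z)) =
      \<Psi> (x * (y * z)) - \<Psi> x * \<Psi> (y * z) - (\<Psi> (x * y) - \<Psi> x * \<Psi> y) * \<Psi> z"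
    if "x \<in> word_span" "y \<in> word_span" "z \<in> word_span" for x y z
  proof -
    have "\<Psi> ((x * (1 - j) * y) * (1 - j) * z) = \<Psi> (x * (1 - j) * (y * z)) - \<Psi> (x * (1 - j) * y) * \<Psi> z"
      using cut[of "x * (1 - j) * y" z] that perp by (simp add: word_span_mult mult.assoc)
    then show ?thesis using cut that by (simp add: word_span_mult mult.assoc)
  qed
  from assms(4,5) consider "r = 1" "s = 1" | b where "r = 1" "s = (1 - j) * b" "b \<in> B"
    | b where "r = b * (1 - j)" "s = 1" "b \<in> B"
    | b b' where "r = b * (1 - j)" "s = (1 - j) * b'" "b \<in> B" "b' \<in> B"
    by blast
  then show ?thesis
  proof cases
    case 1
    then show ?thesis by simp
  next
    case 2
    then show ?thesis
      using cut[OF cM BM[of b]] cut[OF one_in_word_span BM[of b]] facR[of b] by (simp add: mult.assoc)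
  next
    case 3
    then show ?thesis
      using cut[OF BM[of b] cM] cut[OF BM[of b] one_in_word_span] facL[of b] by simp
  next
    case 4
    have "\<Psi> (r * c * s) = \<Psi> c * (\<Psi> (b * b') - \<Psi> b * \<Psi> b')"
      unfolding 4(1,2) using cut2[OF BM cM BM, of b b'] 4(3,4)
      by (simp add: facG facL facR right_diff_distrib)
    moreover have "\<Psi> (r * s) = \<Psi> (b * b') - \<Psi> b * \<Psi> b'"
      unfolding 4(1,2) using cut2[OF BM one_in_word_span BM, of b b'] 4(3,4) by simp
    ultimately show ?thesis by simp
  qed
qed

lemma monotone_independent_alternating:
  assumes "B \<subseteq> G" "C \<subseteq> G" "subalgebra scale C" "freely_independent scale \<phi> (case_bool B C)"
  shows "monotone_independent scale \<Psi> (alternating_idem_algebra scale j B) C"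
proof -
  let ?X = "insert 1 {b * (1 - j) | b. b \<in> B}" and ?Y = "insert 1 {(1 - j) * b | b. b \<in> B}"
  let ?W = "{idem_word j \<epsilon> ps | \<epsilon> ps. set (\<epsilon> # map snd ps) \<subseteq> {- 1, 1} \<and> fst ` set ps \<subseteq> B \<and>
    distinct_adj (\<epsilon> # map snd ps) \<and> - 1 \<in> set (\<epsilon> # map snd ps)}"
  have BM: "B \<subseteq> word_span" using assms(1) G_in_word_span by blast
  have "1 - j \<in> word_span" by (simp add: j_in_word_span one_in_word_span subspace_word_span subspace_diff)
  then have X: "?X \<subseteq> word_span" and Y: "?Y \<subseteq> word_span" using BM one_in_word_span word_span_mult by auto
  show ?thesis
  proof (rule monotone_independent_criterion[OF X Y _ _ assms(2,3)])
    show "subalgebra scale (alternating_idem_algebra scale j B)"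
      unfolding alternating_idem_algebra_def by (rule generated_algebra_subalgebra)
    show "\<Psi> (r * c * s) = \<Psi> c * \<Psi> (r * s)" if "r \<in> ?X" "s \<in> ?Y" "c \<in> C" for r s c
      using Psi_factor_middle_free[OF assms(4,1,2) that] .
    show "alternating_idem_algebra scale j B \<subseteq> span {m * j * r | m r. m \<in> word_span \<and> r \<in> ?X}"
      unfolding alternating_idem_algebra_def
    proof (rule generated_algebra_minimal)
      show "subalgebra scale (span {m * j * r | m r. m \<in> word_span \<and> r \<in> ?X})"
        unfolding subalgebra_def using span_left_ideal[OF X] by blast
      show "?W \<subseteq> span {m * j * r | m r. m \<in> word_span \<and> r \<in> ?X}"
      proof
        fix x assume "x \<in> ?W"
        then obtain \<epsilon> ps where "x = idem_word j \<epsilon> ps" "fst ` set ps \<subseteq> B"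
          "set (\<epsilon> # map snd ps) \<subseteq> {- 1, 1}" "distinct_adj (\<epsilon> # map snd ps)"
          "- 1 \<in> set (\<epsilon> # map snd ps)"
          by blast
        from alternating_idem_word_ending[OF BM this(2-5)] this(1)
        show "x \<in> span {m * j * r | m r. m \<in> word_span \<and> r \<in> ?X}"
          by (simp only: span_base)
      qed
    qed
    show "alternating_idem_algebra scale j B \<subseteq> span {s * j * m | m s. m \<in> word_span \<and> s \<in> ?Y}"
      unfolding alternating_idem_algebra_def
    proof (rule generated_algebra_minimal)
      show "subalgebra scale (span {s * j * m | m s. m \<in> word_span \<and> s \<in> ?Y})"
        unfolding subalgebra_def using span_right_ideal[OF Y] by blast
      show "?W \<subseteq> span {s * j * m | m s. m \<in> word_span \<and> s \<in> ?Y}"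
      proof
        fix x assume "x \<in> ?W"
        then obtain \<epsilon> ps where "x = idem_word j \<epsilon> ps" "fst ` set ps \<subseteq> B"
          "set (\<epsilon> # map snd ps) \<subseteq> {- 1, 1}" "distinct_adj (\<epsilon> # map snd ps)"
          "- 1 \<in> set (\<epsilon> # map snd ps)"
          by blast
        from alternating_idem_word_beginning[OF BM this(2-5)] this(1)
        show "x \<in> span {s * j * m | m s. m \<in> word_span \<and> s \<in> ?Y}"
          by (simp only: span_base)
      qed
    qed
  qed auto
qed

end

theorem theorem5p7:
  fixes scale :: "complex \<Rightarrow> 'a::ring_1 \<Rightarrow> 'a"
    and \<phi> \<phi>' \<psi> :: "'a \<Rightarrow> complex"
    and j :: 'a
    and B C :: "'a set"
  assumes "infinitesimal_probability_space scale \<phi> \<phi>'"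
    and "infinitesimal_idempotent \<phi> j"
    and "\<phi>' j \<noteq> 0"
    and "\<And>a. \<psi> a = \<phi>' (a * j) / \<phi>' j"
    and "unital_subalgebra scale B"
    and "unital_subalgebra scale C"
    and "infinitesimally_free scale \<phi> \<phi>'
           (case_bool (generated_unital_algebra scale (B \<union> C)) (generated_unital_algebra scale {j}))"
  shows "monotone_independent scale \<psi> {j * x * j | x. x \<in> idem_algebra scale j B} C \<and>
         (freely_independent scale \<phi> (case_bool B C) \<longrightarrow>
            monotone_independent scale \<psi> (alternating_idem_algebra scale j B) C)"
proof -
  let ?G = "generated_unital_algebra scale (B \<union> C)"
  interpret infinitesimally_free_idempotent scale \<phi> \<phi>' j ?G
    using assms by (intro infinitesimally_free_idempotent.intro infinitesimally_free_idempotent_axioms.intro)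
  have "\<psi> = \<Psi>" using assms(4) by (auto simp: \<Psi>_def)
  moreover have "B \<subseteq> ?G" "C \<subseteq> ?G" using generated_unital_algebra_superset by blast+
  ultimately show ?thesis
    using monotone_independent_corner monotone_independent_alternating
      unital_subalgebraD(1)[OF assms(6)] by blast
qed

end
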